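(* (1) For every integer $n\ge 33$, \[\max N(0,3;n)=\begin{cases}7^{n/7} & n\equiv 0 \pmod 7\\ 37^2\cdot 16\cdot 7^{(n-36)/7} & n\equiv 1\pmod 7\\ 37\cdot 16\cdot 7^{(n-23)/7} & n\equiv 2\pmod 7\\ 16\cdot 7^{(n-10)/7} & n\equiv 3\pmod 7\\ 37^3\cdot 7^{(n-39)/7} & n\equiv 4\pmod 7\\ 37^2\cdot 7^{(n-26)/7} & n\equiv 5\pmod 7\\ 37\cdot 7^{(n-13)/7} & n\equiv 6\pmod 7,\end{cases}\] and this maximum is attained at a unique partition of $n$, namely: all parts equal to $7$ when $n\equiv 0$; parts $13,13,10$ followed by parts $7$ when $n\equiv1$; parts $13,10$ followed by parts $7$ when $n\equiv 2$; part $10$ followed by parts $7$ when $n\equiv 3$; parts $13,13,13$ followed by parts $7$ when $n\equiv 4$; parts $13,13$ followed by parts $7$ when $n\equiv 5$; part $13$ followed by parts $7$ when $n\equiv 6 \pmod 7$ (in each case with as many parts $7$ as needed to reach $n$, possibly none). (2) For every integer $n\ge 22$, $\max N(1,3;n)=\max N(2,3;n)$ and \[\max N(1,3;n)=\begin{cases}46^{n/14} & n\equiv 0\pmod{14}\\ 59\cdot 46^{(n-15)/14} & n\equiv 1\\ 59^2\cdot 46^{(n-30)/14} & n\equiv 2\\ 101\cdot 46^{(n-17)/14} & n\equiv 3\\ 101\cdot 59\cdot 46^{(n-32)/14} & n\equiv 4\\ 20^3\cdot 46^{(n-33)/14} & n\equiv 5\\ 26\cdot 20^2\cdot 46^{(n-34)/14}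 & n\equiv 6\\ 26^2\cdot 20\cdot 46^{(n-35)/14} & n\equiv 7\\ 20^2\cdot 46^{(n-22)/14} & n\equiv 8\\ 26\cdot 20\cdot 46^{(n-23)/14} & n\equiv 9\\ 26^2\cdot 46^{(n-24)/14} & n\equiv 10\\ 20\cdot 46^{(n-11)/14} & n\equiv 11\\ 26\cdot 46^{(n-12)/14} & n\equiv 12\\ 59\cdot 26\cdot 46^{(n-27)/14} & n\equiv 13 \pmod{14},\end{cases}\] and for both $r=1$ and $r=2$ this maximum is attained at a unique partition of $n$, namely the partition consisting of the following parts together with as many parts $14$ as needed to reach $n$ (possibly none): no other parts when $n\equiv 0$; $15$ when $n\equiv 1$; $15,15$ when $n\equiv 2$; $17$ when $n\equiv 3$; $17,15$ when $n\equiv 4$; $11,11,11$ when $n\equiv 5$; $12,11,11$ when $n\equiv 6$; $12,12,11$ when $n\equiv 7$; $11,11$ when $n\equiv 8$; $12,11$ when $n\equiv 9$; $12,12$ when $n\equiv 10$; $11$ when $n\equiv 11$; $12$ when $n\equiv 12$; $15,12$ when $n\equiv 13\pmod{14}$.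
   Context: A partition of $n$ is a finite nonincreasing sequence of positive integers $\lambda=(\lambda_1,\dots,\lambda_k)$ summing to $n$; $P(n)$ is the set of partitions of $n$. The rank of $\lambda$ is $\lambda_1-k$. For integers $r$ and $t\ge1$, $N(r,t;n)$ is the number of partitions of $n$ with rank $\equiv r\pmod t$. This is extended multiplicatively to partitions by $N(r,3;\lambda):=\prod_{j=1}^k N(r,3;\lambda_j)$, and $\max N(r,3;n):=\max\{N(r,3;\lambda):\lambda\in P(n)\}$. *)

theory Defs
  imports Main "HOL-Number_Theory.Cong"
begin

definition partitions_of :: "nat \<Rightarrow> nat list set" where
  "partitions_of n = {xs. sorted_wrt (\<ge>) xs \<and> (\<forall>x\<in>set xs. 0 < x) \<and> sum_list xs = n}"

(* The empty partition, which has no largest part, is given rank 0. *)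
definition partition_rank :: "nat list \<Rightarrow> int" where
  "partition_rank xs = (case xs of [] \<Rightarrow> 0 | x # _ \<Rightarrow> int x - int (length xs))"

definition rank_count :: "int \<Rightarrow> int \<Rightarrow> nat \<Rightarrow> nat" where
  "rank_count r t n = card {xs \<in> partitions_of n. [partition_rank xs = r] (mod t)}"

definition rank_count_mult :: "int \<Rightarrow> int \<Rightarrow> nat list \<Rightarrow> nat" where
  "rank_count_mult r t xs = (\<Prod>x\<leftarrow>xs. rank_count r t x)"

definition max_rank_count :: "int \<Rightarrow> int \<Rightarrow> nat \<Rightarrow> nat" where
  "max_rank_count r t n = Max (rank_count_mult r t ` partitions_of n)"

definition maximizers :: "int \<Rightarrow> int \<Rightarrow> nat \<Rightarrow> nat list set" where
  "maximizers r t n = {xs \<in> partitions_of n. rank_count_mult r t xs = max_rank_count r t n}"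

text \<open>\<^const>\<open>Max\<close> and \<^const>\<open>card\<close> above are only ever applied to finite sets.\<close>

lemma finite_partitions_of: "finite (partitions_of n)"
proof (rule finite_subset)
  have len: "length xs \<le> sum_list xs" if "\<forall>x\<in>set xs. 0 < x" for xs :: "nat list"
    using that by (induction xs) (auto simp: Suc_le_eq)
  show "partitions_of n \<subseteq> {xs. set xs \<subseteq> {..n} \<and> length xs \<le> n}"
    unfolding partitions_of_def using len member_le_sum_list by fastforce
  show "finite {xs. set xs \<subseteq> {..n} \<and> length xs \<le> n}"
    by (rule finite_lists_length_le) simp
qed

lemma partitions_of_nonempty: "partitions_of n \<noteq> {}"
proof -
  have "(if n = 0 then [] else [n]) \<in> partitions_of n"
    by (simp add: partitions_of_def)
  then show ?thesis by blast
qed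

end

theory Submission
  imports Defs Complex_Main "HOL-Library.Multiset"
begin

text \<open>
  Let F n be the product of f over the parts of the claimed optimal partition of n, where f is the
  rank count.  If f m \<le> F m for all m > 0 and F m * F k \<le> F (m + k), then removing the parts of an
  arbitrary partition one by one bounds its product by F n, and uniqueness follows by tracking when
  both inequalities are equalities.  Up to a factor 7 (resp. 46) for each further part 7 (resp. 14),
  F is eventually periodic, so supermultiplicativity is a finite check.  The comparison f m \<le> F m
  is read off a table of rank counts for m \<le> 40; beyond that, f m is at most the number p(m) of
  partitions, and p(m) \<le> 7.44 * 1.25^m is already smaller than F m.  This bound on p follows by
  induction from the identity n p(n) = (\<Sum>j. j * c_j(n)), where c_j(n), the number of parts j in all
  partitions of n, satisfies c_j(n) = p(n - j) + c_j(n - j).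
\<close>

subsection \<open>Rank counts of small numbers\<close>

text \<open>Once the largest part \<open>a\<close> is removed, the rank modulo 3 depends only on
  \<open>a\<close> and the number of remaining parts modulo 3, and those parts are at most
  \<open>a\<close>. This joint statistic satisfies a simple recursion.\<close>

definition parts_le_count :: "nat \<Rightarrow> nat \<Rightarrow> nat \<Rightarrow> nat" where
  "parts_le_count a n i =
     card {xs \<in> partitions_of n. (\<forall>x\<in>set xs. x \<le> a) \<and> length xs mod 3 = i}"

section \<open>Recursion for the counts by length modulo 3\<close>

lemma finite_partitions_of_Collect [simp]: "finite {xs \<in> partitions_of n. P xs}"
  using finite_partitions_of by simp

lemma Cons_in_partitions_of:
  "a # xs \<in> partitions_of n \<longleftrightarrow>
     0 < a \<and> a \<le> n \<and> xs \<in> partitions_of (n - a) \<and> (\<forall>x\<in>set xs. x \<le> a)"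
  by (auto simp: partitions_of_def)

lemma part_le: "xs \<in> partitions_of n \<Longrightarrow> x \<in> set xs \<Longrightarrow> x \<le> n"
  by (auto simp: partitions_of_def intro: member_le_sum_list)

lemma parts_le_count_ge: "n \<le> a \<Longrightarrow> parts_le_count a n i = parts_le_count n n i"
  unfolding parts_le_count_def
  by (rule arg_cong[where f = card]) (use part_le in fastforce)

lemma parts_le_count_0: "parts_le_count 0 n i = (if n = 0 \<and> i = 0 then 1 else 0)"
proof -
  have *: "(xs \<in> partitions_of n \<and> (\<forall>x\<in>set xs. x \<le> 0) \<and> length xs mod 3 = i) =
      (xs = [] \<and> n = 0 \<and> i = 0)" for xs
  proof (cases xs)
    case Nil
    then show ?thesis by (auto simp: partitions_of_def)
  next
    case (Cons x ys)
    have "\<not> (xs \<in> partitions_of n \<and> (\<forall>x\<in>set xs. x \<le> 0))"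
      unfolding Cons Cons_in_partitions_of by auto
    then show ?thesis using Cons by blast
  qed
  have "{xs \<in> partitions_of n. (\<forall>x\<in>set xs. x \<le> 0) \<and> length xs mod 3 = i} =
      (if n = 0 \<and> i = 0 then {[]} else {})"
    unfolding * by simp
  then show ?thesis by (simp add: parts_le_count_def)
qed

text \<open>A partition counted on the left either avoids the part \<open>Suc a\<close> or begins
  with it. Deleting that first part lowers the length by one, which modulo 3 is written
  \<open>i + 2\<close> to stay within the natural numbers.\<close>

lemma parts_le_count_Suc:
  assumes "Suc a \<le> n" "i < 3"
  shows "parts_le_count (Suc a) n i =
    parts_le_count a n i + parts_le_count (Suc a) (n - Suc a) ((i + 2) mod 3)"
proof -
  let ?S = "\<lambda>a n i. {xs \<in> partitions_of n. (\<forall>x\<in>set xs. x \<le> a) \<and> length xs mod 3 = i}"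
  have "?S (Suc a) n i = ?S a n i \<union> (#) (Suc a) ` ?S (Suc a) (n - Suc a) ((i + 2) mod 3)"
  proof (intro equalityI subsetI)
    fix xs assume xs: "xs \<in> ?S (Suc a) n i"
    then have "xs \<noteq> []" using assms by (auto simp: partitions_of_def)
    then obtain x ys where xs_eq: "xs = x # ys" by (cases xs) blast+
    have "xs \<in> partitions_of n" and "\<forall>x\<in>set xs. x \<le> Suc a"
      and len: "length xs mod 3 = i"
      using xs by auto
    then have part: "x # ys \<in> partitions_of n" and "x \<le> Suc a"
      unfolding xs_eq by simp_all
    have dom: "\<forall>y\<in>set ys. y \<le> x"
      using part unfolding Cons_in_partitions_of by blast
    show "xs \<in> ?S a n i \<union> (#) (Suc a) ` ?S (Suc a) (n - Suc a) ((i + 2) mod 3)"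
    proof (cases "x = Suc a")
      case True
      have "length ys mod 3 = (i + 2) mod 3"
        using len mod_add_left_eq[of "Suc (length ys)" 3 2] by (simp add: xs_eq)
      moreover have "ys \<in> partitions_of (n - Suc a)"
        using part True unfolding Cons_in_partitions_of by blast
      ultimately show ?thesis using dom True xs_eq by blast
    next
      case False
      then have "x \<le> a" using \<open>x \<le> Suc a\<close> by simp
      then have "\<forall>y\<in>set xs. y \<le> a" using dom xs_eq by auto
      then show ?thesis using xs by blast
    qed
  next
    fix xs assume "xs \<in> ?S a n i \<union> (#) (Suc a) ` ?S (Suc a) (n - Suc a) ((i + 2) mod 3)"
    then show "xs \<in> ?S (Suc a) n i"
    proof
      assume "xs \<in> (#) (Suc a) ` ?S (Suc a) (n - Suc a) ((i + 2) mod 3)"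
      then obtain ys where xs_eq: "xs = Suc a # ys"
        and part: "ys \<in> partitions_of (n - Suc a)" and dom: "\<forall>y\<in>set ys. y \<le> Suc a"
        and len: "length ys mod 3 = (i + 2) mod 3" by blast
      have "length xs mod 3 = i"
        using len assms(2) mod_Suc_eq[of "length ys" 3] mod_Suc_eq[of "i + 2" 3]
        by (simp add: xs_eq)
      moreover have "xs \<in> partitions_of n"
        using part dom assms(1) unfolding xs_eq Cons_in_partitions_of by blast
      ultimately show ?thesis using dom xs_eq by simp
    qed (auto simp: le_SucI)
  qed
  moreover have "?S a n i \<inter> (#) (Suc a) ` ?S (Suc a) (n - Suc a) ((i + 2) mod 3) = {}"
    by auto
  ultimately show ?thesis
    unfolding parts_le_count_def
    by (simp add: card_Un_disjoint card_image)
qed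

text \<open>Partitions are sorted by their first part \<open>a\<close>. With tail \<open>ys\<close>
  the rank is a - 1 - length ys, so it is congruent to r exactly when length ys is congruent to a -
  1 - r.\<close>

lemma rank_count_eq_sum:
  assumes "0 < n"
  shows "rank_count r 3 n =
    (\<Sum>a=1..n. parts_le_count a (n - a) (nat ((int a - 1 - r) mod 3)))"
proof -
  define R where "R a = nat ((int a - 1 - r) mod 3)" for a :: nat
  let ?S = "\<lambda>a. {ys \<in> partitions_of (n - a). (\<forall>y\<in>set ys. y \<le> a) \<and> length ys mod 3 = R a}"
  have residue: "[partition_rank (a # ys) = r] (mod 3) \<longleftrightarrow> length ys mod 3 = R a" for a ys
  proof -
    have "[partition_rank (a # ys) = r] (mod 3) \<longleftrightarrow> int (length ys) mod 3 = (int a - 1 - r) mod 3"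
      using dvd_diff_commute[of 3 "int (length ys)" "int a - 1 - r"]
      by (simp add: partition_rank_def cong_def mod_eq_dvd_iff algebra_simps)
    also have "\<dots> \<longleftrightarrow> nat (int (length ys mod 3)) = nat ((int a - 1 - r) mod 3)"
      by (simp only: of_nat_mod of_nat_numeral) (rule eq_nat_nat_iff[symmetric], simp_all)
    finally show ?thesis by (simp add: R_def)
  qed
  have "{xs \<in> partitions_of n. [partition_rank xs = r] (mod 3)} = (\<Union>a\<in>{1..n}. (#) a ` ?S a)"
  proof (intro equalityI subsetI)
    fix xs assume xs: "xs \<in> {xs \<in> partitions_of n. [partition_rank xs = r] (mod 3)}"
    then have "xs \<noteq> []" using assms by (auto simp: partitions_of_def)
    then obtain x ys where xs_eq: "xs = x # ys" by (cases xs) auto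
    then have "x \<in> {1..n}" "ys \<in> ?S x"
      using xs residue[of x ys] by (auto simp: Cons_in_partitions_of)
    then show "xs \<in> (\<Union>a\<in>{1..n}. (#) a ` ?S a)"
      using xs_eq by blast
  next
    fix xs assume "xs \<in> (\<Union>a\<in>{1..n}. (#) a ` ?S a)"
    then obtain a ys where a: "a \<in> {1..n}" "xs = a # ys" "ys \<in> ?S a" by blast
    then show "xs \<in> {xs \<in> partitions_of n. [partition_rank xs = r] (mod 3)}"
      using residue[of a ys] by (simp add: Cons_in_partitions_of)
  qed
  then have "rank_count r 3 n = card (\<Union>a\<in>{1..n}. (#) a ` ?S a)"
    by (simp add: rank_count_def)
  also have "\<dots> = (\<Sum>a=1..n. card ((#) a ` ?S a))"
    by (rule card_UN_disjoint) auto
  also have "\<dots> = (\<Sum>a=1..n. parts_le_count a (n - a) (nat ((int a - 1 - r) mod 3)))"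
    by (simp add: parts_le_count_def card_image R_def)
  finally show ?thesis .
qed

lemma card_partitions_of_eq_sum_rank_count:
  "card (partitions_of n) = rank_count 0 3 n + rank_count 1 3 n + rank_count 2 3 n"
proof -
  let ?S = "\<lambda>r. {xs \<in> partitions_of n. [partition_rank xs = r] (mod 3)}"
  have "(x::int) mod 3 = 0 \<or> x mod 3 = 1 \<or> x mod 3 = 2" for x by presburger
  then have "partitions_of n = ?S 0 \<union> ?S 1 \<union> ?S 2"
    by (auto simp: cong_def)
  moreover have "?S 0 \<inter> ?S 1 = {}" "(?S 0 \<union> ?S 1) \<inter> ?S 2 = {}"
    by (auto simp: cong_def)
  ultimately show ?thesis
    unfolding rank_count_def by (metis (no_types, lifting) card_Un_disjoint finite_Un finite_partitions_of)
qed

text \<open>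
  The counts by length modulo 3 are tabulated by columns: \<open>col n\<close> lists them for the bounds
  0, \<dots>, n on the parts, and larger bounds give the same counts as the bound n.  A column is
  computed in one traversal of the previous ones, latest first.
\<close>

type_synonym triple = "nat \<times> nat \<times> nat"

text \<open>Adjoining one part moves each length residue up by one, so the second triple enters
  cyclically shifted.\<close>

fun add_rotated :: "triple \<Rightarrow> triple \<Rightarrow> triple" where
  "add_rotated (u, v, w) (x, y, z) = (u + z, v + x, w + y)"

definition length_counts :: "nat \<Rightarrow> nat \<Rightarrow> triple" where
  "length_counts a n = (parts_le_count a n 0, parts_le_count a n 1, parts_le_count a n 2)"

definition col :: "nat \<Rightarrow> triple list" where
  "col n = map (\<lambda>a. length_counts a n) [0..<Suc n]"

text \<open>When the column of n is built, \<open>v\<close> belongs to the bound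
  \<open>a - 1\<close> and \<open>c\<close> is the column of \<open>n - a\<close>. The cap by
  \<open>min\<close> is valid because all bounds above \<open>n - a\<close> count the same
  partitions.\<close>

fun extend_column :: "nat \<Rightarrow> triple \<Rightarrow> triple list list \<Rightarrow> triple list" where
  "extend_column a v [] = [v]"
| "extend_column a v (c # cs) =
     v # extend_column (Suc a) (add_rotated v (c ! min a (length c - 1))) cs"

lemma col_nth: "col n ! min a (length (col n) - 1) = length_counts a n"
  by (cases "a \<le> n") (auto simp: col_def nth_append length_counts_def min_def parts_le_count_ge[of n a] simp del: upt_Suc)

lemma length_counts_Suc:
  assumes "Suc a \<le> n"
  shows "length_counts (Suc a) n = add_rotated (length_counts a n) (length_counts (Suc a) (n - Suc a))"
  using assms by (simp add: length_counts_def parts_le_count_Suc numeral_2_eq_2)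

lemma extend_column_eq:
  "a + k = n \<Longrightarrow> extend_column (Suc a) (length_counts a n) (map col (rev [0..<k])) =
     map (\<lambda>b. length_counts b n) [a..<Suc n]"
proof (induction k arbitrary: a)
  case (Suc k)
  have "k = n - Suc a" using Suc.prems by simp
  then show ?case
    using Suc.IH[of "Suc a"] Suc.prems col_nth[of k "Suc a"] length_counts_Suc[of a n]
    by (simp add: upt_conv_Cons[of a] del: upt_Suc) simp
qed simp

lemma col_Suc: "col (Suc n) = extend_column 1 (0, 0, 0) (map col (rev [0..<Suc n]))"
  using extend_column_eq[of 0 "Suc n" "Suc n"]
  by (simp add: col_def length_counts_def parts_le_count_0 del: upt_Suc)

text \<open>The sum over the largest part \<open>a\<close> for the rank residues 0, 1, 2 at once:
  the required length residues a - 1, a - 2, a - 3 permute the column entry according to a mod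
  3.\<close>

fun rank_triple :: "nat \<Rightarrow> triple list list \<Rightarrow> triple" where
  "rank_triple a [] = (0, 0, 0)"
| "rank_triple a (c # cs) =
     (case c ! min a (length c - 1) of (x, y, z) \<Rightarrow>
      case rank_triple (Suc a) cs of (u, v, w) \<Rightarrow>
        if a mod 3 = 1 then (u + x, v + z, w + y)
        else if a mod 3 = 2 then (u + y, v + x, w + z)
        else (u + z, v + y, w + x))"

definition rank_counts :: "nat \<Rightarrow> triple" where
  "rank_counts n = (rank_count 0 3 n, rank_count 1 3 n, rank_count 2 3 n)"

lemma rank_triple_eq:
  assumes "a + k = n"
  shows "rank_triple (Suc a) (map col (rev [0..<k])) =
    (let S = \<lambda>r. \<Sum>b=Suc a..n. parts_le_count b (n - b) (nat ((int b - 1 - r) mod 3))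
     in (S 0, S 1, S 2))"
  using assms
proof (induction k arbitrary: a)
  case (Suc k)
  have k: "k = n - Suc a" "Suc a \<le> n" using Suc.prems by auto
  \<comment> \<open>The first summand has largest part \<open>Suc a\<close>, so the wanted residues
    are those of a, a - 1 and a - 2. Adding 3 keeps the last two nonnegative.\<close>
  have residues: "nat (int a mod 3) = a mod 3" "nat ((int a - 1) mod 3) = (a + 2) mod 3"
    "nat ((int a - 2) mod 3) = (a + 1) mod 3"
  proof -
    have "(int a - 1) mod 3 = (int a + 2) mod 3" "(int a - 2) mod 3 = (int a + 1) mod 3"
      by presburger+
    then have "(int a - 1) mod 3 = int ((a + 2) mod 3)" "(int a - 2) mod 3 = int ((a + 1) mod 3)"
      by (simp_all add: zmod_int add.commute)
    then show "nat (int a mod 3) = a mod 3" "nat ((int a - 1) mod 3) = (a + 2) mod 3"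
      "nat ((int a - 2) mod 3) = (a + 1) mod 3"
      by (simp_all add: nat_mod_distrib)
  qed
  have "Suc a mod 3 = (if a mod 3 = 2 then 0 else Suc (a mod 3))"
    by presburger
  moreover have "(a + 2) mod 3 = (if a mod 3 = 0 then 2 else a mod 3 - 1)"
    by presburger
  moreover have "a mod 3 = 0 \<or> a mod 3 = 1 \<or> a mod 3 = 2"
    by presburger
  ultimately show ?case
    using Suc.IH[of "Suc a"] Suc.prems col_nth[of k "Suc a"] residues
    by (auto simp: sum.atLeast_Suc_atMost[OF k(2)] Let_def length_counts_def k(1)[symmetric])
qed (simp add: Let_def)

text \<open>The first list serves as a round counter. Each round evaluates one number and then
  pushes its column, which all later rounds share.\<close>

fun rank_table :: "'a list \<Rightarrow> triple list list \<Rightarrow> triple list" where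
  "rank_table [] cs = []"
| "rank_table (x # xs) cs = rank_triple 1 cs # rank_table xs (extend_column 1 (0, 0, 0) cs # cs)"

lemma rank_table_eq:
  "0 < n \<Longrightarrow> rank_table xs (map col (rev [0..<n])) = map rank_counts [n..<n + length xs]"
proof (induction xs arbitrary: n)
  case (Cons x xs)
  obtain m where n: "n = Suc m" using Cons.prems by (cases n) auto
  have "rank_triple 1 (map col (rev [0..<n])) = rank_counts n"
    using rank_triple_eq[of 0 n n] Cons.prems
    by (simp add: rank_counts_def rank_count_eq_sum Let_def)
  moreover have "extend_column 1 (0, 0, 0) (map col (rev [0..<n])) # map col (rev [0..<n]) =
      map col (rev [0..<Suc n])"
    using col_Suc[of m] by (simp add: n)
  ultimately show ?case
    using Cons.IH[of "Suc n"] by (simp add: upt_conv_Cons del: upt_Suc)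
qed simp

text \<open>The recursion is evaluated by simplification. The table ends at 40, since from 41 on the
  exponential bound on p suffices.\<close>

lemma rank_counts_table:
  "map rank_counts [1..<41] =
    [(1, 0, 0), (0, 1, 1), (1, 1, 1), (3, 1, 1), (1, 3, 3), (3, 4, 4), (7, 4, 4), (6, 8, 8),
    (10, 10, 10), (16, 13, 13), (16, 20, 20), (25, 26, 26), (37, 32, 32), (43, 46, 46), (58,
    59, 59), (81, 75, 75), (95, 101, 101), (127, 129, 129), (168, 161, 161), (205, 211,
    211), (264, 264, 264), (340, 331, 331), (413, 421, 421), (523, 526, 526), (660, 649,
    649), (806, 815, 815), (1002, 1004, 1004), (1248, 1235, 1235), (1513, 1526, 1526),
    (1866, 1869, 1869), (2292, 2275, 2275), (2775, 2787, 2787), (3379, 3382, 3382), (4116,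
    4097, 4097), (4949, 4967, 4967), (5989, 5994, 5994), (7227, 7205, 7205), (8659, 8678,
    8678), (10393, 10396, 10396), (12464, 12437, 12437)]"
  (is "_ = ?table")
proof -
  have upt: "[1..<41::nat] = 1 # [Suc 1..<41]"
    by (rule upt_conv_Cons) simp
  \<comment> \<open>The starting list holds the column of 0, whose only partition is the empty one,
    of length 0.\<close>
  have "map rank_counts [1..<41] = rank_table [1..<41::nat] [[(1, 0, 0)]]"
    using rank_table_eq[of 1 "[1..<41::nat]"]
    by (simp add: col_def length_counts_def parts_le_count_0 del: upt_rec_numeral)
  also have "\<dots> = ?table"
    unfolding upt by (simp del: One_nat_def)
  finally show ?thesis .
qed

subsection \<open>An exponential bound on the number of partitions\<close>

text \<open>As multisets, partitions allow a part to be inserted or removed without regard to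
  order.\<close>

definition mset_partitions :: "nat \<Rightarrow> nat multiset set" where
  "mset_partitions n = {M. 0 \<notin># M \<and> sum_mset M = n}"

lemma bij_betw_mset_partitions: "bij_betw mset (partitions_of n) (mset_partitions n)"
  unfolding bij_betw_def
proof
  show "inj_on mset (partitions_of n)"
  proof (rule inj_onI)
    fix xs ys assume "xs \<in> partitions_of n" "ys \<in> partitions_of n" "mset xs = mset ys"
    then have "sorted (rev xs)" "sorted (rev ys)" "mset (rev xs) = mset (rev ys)"
      by (auto simp: partitions_of_def sorted_wrt_rev)
    then show "xs = ys"
      by (metis properties_for_sort rev_rev_ident)
  qed
  show "mset ` partitions_of n = mset_partitions n"
  proof (intro equalityI subsetI)
    fix M assume "M \<in> mset_partitions n"
    then have "rev (sorted_list_of_multiset M) \<in> partitions_of n"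
      by (auto simp: mset_partitions_def partitions_of_def sorted_wrt_rev
          simp flip: sum_mset_sum_list intro!: gr0I)
    then show "M \<in> mset ` partitions_of n"
      by (rule rev_image_eqI) simp
  qed (auto simp: mset_partitions_def partitions_of_def sum_mset_sum_list)
qed

lemma finite_mset_partitions: "finite (mset_partitions n)"
  using bij_betw_finite[OF bij_betw_mset_partitions] finite_partitions_of by blast

lemma card_mset_partitions: "card (mset_partitions n) = card (partitions_of n)"
  using bij_betw_same_card[OF bij_betw_mset_partitions] by simp

section \<open>Occurrences of a part in all partitions of a number\<close>

definition part_count :: "nat \<Rightarrow> nat \<Rightarrow> nat" where
  "part_count j n = (\<Sum>M\<in>mset_partitions n. count M j)"

lemma elem_le_sum_mset: "x \<in># M \<Longrightarrow> x \<le> sum_mset M" for x :: nat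
  by (auto dest: multi_member_split)

lemma sum_mset_eq_sum_count:
  assumes "sum_mset M \<le> n"
  shows "sum_mset M = (\<Sum>j=1..n. j * count M j)"
proof -
  have "set_mset M \<subseteq> {..n}"
    using assms le_trans[OF elem_le_sum_mset] by auto
  then have "sum_mset M = (\<Sum>j\<le>n. j * count M j)"
  proof (induction M)
    case (add x M)
    then have "(\<Sum>j\<le>n. j * count (add_mset x M) j) = (\<Sum>j\<le>n. j * count M j) + (\<Sum>j\<le>n. if j = x then j else 0)"
      by (subst sum.distrib[symmetric]) (rule sum.cong, auto)
    then show ?case using add by simp
  qed simp
  also have "\<dots> = (\<Sum>j=1..n. j * count M j)"
    by (rule sum.mono_neutral_right) auto
  finally show ?thesis .
qed

text \<open>Double counting: the total of all parts of all partitions of n is n for each partition,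
  and can also be collected by part size.\<close>

lemma card_partitions_eq_sum_part_count:
  "n * card (partitions_of n) = (\<Sum>j=1..n. j * part_count j n)"
proof -
  have "n * card (partitions_of n) = (\<Sum>M\<in>mset_partitions n. sum_mset M)"
    by (simp add: mset_partitions_def flip: card_mset_partitions)
  also have "\<dots> = (\<Sum>M\<in>mset_partitions n. \<Sum>j=1..n. j * count M j)"
    by (intro sum.cong refl sum_mset_eq_sum_count) (simp add: mset_partitions_def)
  also have "\<dots> = (\<Sum>j=1..n. j * part_count j n)"
    by (subst sum.swap) (simp add: part_count_def sum_distrib_left)
  finally show ?thesis .
qed

text \<open>Removing one copy of j maps the partitions of n that contain j bijectively to the
  partitions of n - j, and each loses one occurrence of j.\<close>

lemma part_count_rec:
  assumes "0 < j"
  shows "part_count j n = (if j \<le> n then card (partitions_of (n - j)) + part_count j (n - j) else 0)"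
proof (cases "j \<le> n")
  case True
  have "{M \<in> mset_partitions n. j \<in># M} = add_mset j ` mset_partitions (n - j)"
  proof (intro equalityI subsetI)
    fix M assume "M \<in> {M \<in> mset_partitions n. j \<in># M}"
    then have "M - {#j#} \<in> mset_partitions (n - j)" "M = add_mset j (M - {#j#})"
      by (auto simp: mset_partitions_def sum_mset.remove dest: in_diffD)
    then show "M \<in> add_mset j ` mset_partitions (n - j)" by blast
  qed (use assms True in \<open>auto simp: mset_partitions_def\<close>)
  moreover have "part_count j n = (\<Sum>M\<in>{M \<in> mset_partitions n. j \<in># M}. count M j)"
    unfolding part_count_def
    by (rule sum.mono_neutral_right) (auto simp: finite_mset_partitions not_in_iff)
  ultimately have "part_count j n = (\<Sum>M\<in>add_mset j ` mset_partitions (n - j). count M j)"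
    by simp
  also have "\<dots> = (\<Sum>M\<in>mset_partitions (n - j). 1 + count M j)"
    by (subst sum.reindex) (auto simp: inj_on_def)
  also have "\<dots> = card (partitions_of (n - j)) + part_count j (n - j)"
    unfolding sum.distrib part_count_def by (simp flip: card_mset_partitions)
  finally show ?thesis using True by simp
next
  case False
  have "count M j = 0" if "M \<in> mset_partitions n" for M
    using that False elem_le_sum_mset[of j M] by (auto simp: mset_partitions_def count_eq_zero_iff)
  then show ?thesis using False by (simp add: part_count_def)
qed

text \<open>Unfolding the recursion gives p(n - j) + p(n - 2j) + ..., which the assumed bound
  dominates by a geometric series with ratio x^(-j). The induction carries its closed form.\<close>

lemma part_count_le:
  fixes x C :: real
  assumes "0 < j" "1 < x" "\<And>m. m < n \<Longrightarrow> real (card (partitions_of m)) \<le> C * x ^ m" "0 \<le> C"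
  shows "real (part_count j n) \<le> C * x ^ n / (x ^ j - 1)"
  using assms(3)
proof (induction n rule: less_induct)
  case (less n)
  have x: "1 < x ^ j" using assms(1,2) by simp
  show ?case
  proof (cases "j \<le> n")
    case True
    have "real (part_count j n) = real (card (partitions_of (n - j))) + real (part_count j (n - j))"
      using part_count_rec[OF assms(1), of n] True by simp
    also have "\<dots> \<le> C * x ^ (n - j) + C * x ^ (n - j) / (x ^ j - 1)"
      using less True assms(1) by (intro add_mono) auto
    also have "\<dots> = C * (x ^ (n - j) * x ^ j) / (x ^ j - 1)"
      using x by (simp add: field_simps)
    also have "x ^ (n - j) * x ^ j = x ^ n"
      using True by (simp flip: power_add)
    finally show ?thesis .
  next
    case False
    then show ?thesis
      using part_count_rec[OF assms(1), of n] x assms(2,4) by simp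
  qed
qed

text \<open>
  The bound 41 only has to be at most the first n that is not covered by a table.  The
  correction term in the induction is chosen such that it telescopes:
  (n + 5) y^n - (n + 6) y^(n + 1) is proportional to (n + 1) y^(n + 1) for y = 4/5.
\<close>

lemma sum_weights_le:
  "(\<Sum>j=1..n. real j / ((5 / 4) ^ j - 1)) \<le> 41"
proof -
  let ?u = "\<lambda>j. real j / ((5 / 4) ^ j - 1)"
  have tail: "(\<Sum>j=1..n. ?u j) \<le> 41 - 5 * (real n + 5) * (4 / 5) ^ n" if "7 \<le> n" for n
    using that
  proof (induction n rule: dec_induct)
    case base
    have "{1..7} = {1, 2, 3, 4, 5, 6, 7::nat}" by auto
    then show ?case by (simp add: power_divide)
  next
    case (step n)
    define y :: real where "y = (4 / 5) ^ Suc n"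
    \<comment> \<open>The exponent 8 is the first with (4/5)^8 \<le> 1/5, which makes 1 / (1 - y) at
      most 5/4. Hence the induction starts at n = 7.\<close>
    have "y \<le> (4 / 5) ^ 8" unfolding y_def using step by (intro power_decreasing) auto
    also have "(4 / 5 :: real) ^ 8 \<le> 1 / 5" by (simp add: power_divide)
    finally have y: "0 < y" "y \<le> 1 / 5" by (simp_all add: y_def)
    have "(5 / 4) ^ Suc n = 1 / y" by (simp add: y_def power_divide field_simps)
    then have "?u (Suc n) = real (Suc n) * (y / (1 - y))" using y by (simp add: field_simps)
    also have "\<dots> \<le> real (Suc n) * (5 / 4 * y)"
      using y by (intro mult_left_mono) (simp_all add: field_simps)
    finally have u: "?u (Suc n) \<le> real (Suc n) * (5 / 4 * y)" .
    have y_eq: "(4 / 5) ^ n = 5 / 4 * y" by (simp add: y_def)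
    have IH: "(\<Sum>j=1..n. ?u j) \<le> 41 - 5 * (real n + 5) * (5 / 4 * y)"
      using step.IH unfolding y_eq .
    have "(\<Sum>j=1..Suc n. ?u j) = (\<Sum>j=1..n. ?u j) + ?u (Suc n)"
      by simp
    also have "\<dots> \<le> 41 - 5 * (real n + 5) * (5 / 4 * y) + real (Suc n) * (5 / 4 * y)"
      by (rule add_mono[OF IH u])
    also have "\<dots> = 41 - 5 * (real (Suc n) + 5) * y"
      by (simp add: algebra_simps)
    finally show ?case by (simp only: y_def)
  qed
  \<comment> \<open>The terms are nonnegative, so padding by 7 brings small n into the range of
    \<open>tail\<close>.\<close>
  have "(\<Sum>j=1..n. ?u j) \<le> (\<Sum>j=1..n + 7. ?u j)"
    by (rule sum_mono2) auto
  also have "\<dots> \<le> 41"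
    using tail[of "n + 7"] by (rule order_trans) simp_all
  finally show ?thesis .
qed

text \<open>By strong induction, the identity for n p(n) and the bound on part counts give n p(n)
  \<le> 41 C (5/4)^n, and 41 \<le> n outside the assumed range.\<close>

lemma card_partitions_of_le_exp:
  fixes C :: real
  assumes "\<And>n. n \<le> 40 \<Longrightarrow> real (card (partitions_of n)) \<le> C * (5 / 4) ^ n" "0 \<le> C"
  shows "real (card (partitions_of n)) \<le> C * (5 / 4) ^ n"
proof (induction n rule: less_induct)
  case (less n)
  show ?case
  proof (cases "n \<le> 40")
    case False
    have "real n * card (partitions_of n) = (\<Sum>j=1..n. real j * part_count j n)"
      by (metis (mono_tags, lifting) card_partitions_eq_sum_part_count of_nat_mult of_nat_sum sum.cong)
    also have "\<dots> \<le> (\<Sum>j=1..n. real j * (C * (5 / 4) ^ n / ((5 / 4) ^ j - 1)))"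
      using less assms(2) by (intro sum_mono mult_left_mono part_count_le) auto
    also have "\<dots> = (C * (5 / 4) ^ n) * (\<Sum>j=1..n. real j / ((5 / 4) ^ j - 1))"
      by (simp add: sum_distrib_left field_simps)
    also have "\<dots> \<le> (C * (5 / 4) ^ n) * real n"
      using False assms(2) by (intro mult_left_mono order_trans[OF sum_weights_le]) auto
    finally show ?thesis using False by (simp add: mult.commute)
  qed (use assms in simp)
qed

subsection \<open>Maximising a product over the parts of a partition\<close>

text \<open>The guards \<open>n < p\<close> and \<open>p = 0\<close> force the recursive argument to
  decrease for arbitrary input.\<close>

function canon :: "nat \<Rightarrow> nat list list \<Rightarrow> nat \<Rightarrow> nat multiset" where
  "canon p L n = (if n < length L \<or> n < p \<or> p = 0 then mset (L ! n) else add_mset p (canon p L (n - p)))"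
  by auto
termination by (relation "measure (\<lambda>(p, L, n). n)") auto

declare canon.simps [simp del]

text \<open>
  \<open>L\<close> lists optimal partitions of the small numbers, and further ones arise by adding parts \<open>p\<close>.
  \<open>X\<close> contains the small numbers whose optimal partition is not unique (or has product 0), and
  \<open>E\<close> the parts that can occur in an optimal partition.
\<close>

locale periodic_maximum =
  fixes f :: "nat \<Rightarrow> nat" and p :: nat and L :: "nat list list" and E X :: "nat set"
    and F :: "nat \<Rightarrow> nat"
  defines "F n \<equiv> prod_mset (image_mset f (canon p L n))"
  assumes period: "0 < p" "p \<le> length L"
    and sum_table: "\<And>n. n < length L \<Longrightarrow> 0 \<notin> set (L ! n) \<and> sum_list (L ! n) = n"
    and super_table: "\<And>m k. m < length L \<Longrightarrow> k < length L \<Longrightarrow> F m * F k \<le> F (m + k)"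
    and f_le: "\<And>m. 0 < m \<Longrightarrow> f m \<le> F m"
    and f_eq: "\<And>m. 0 < m \<Longrightarrow> f m = F m \<Longrightarrow> m \<in> E"
    and unique_table: "\<And>m k. m \<in> E \<Longrightarrow> k < length L \<Longrightarrow> m + k \<notin> X \<Longrightarrow> F m * F k = F (m + k) \<Longrightarrow>
      k \<notin> X \<and> canon p L (m + k) = add_mset m (canon p L k)"
    and exceptional: "X \<subseteq> {..<length L - p}"
    and pos_table: "\<And>n. n < length L \<Longrightarrow> n \<notin> X \<Longrightarrow> 0 < F n"
    and pos_period: "0 < f p"
begin

section \<open>From the table to all numbers\<close>

lemma canon_lt: "n < length L \<Longrightarrow> canon p L n = mset (L ! n)"
  by (simp add: canon.simps)

lemma canon_ge: "length L \<le> n \<Longrightarrow> canon p L n = add_mset p (canon p L (n - p))"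
  using period by (subst canon.simps) auto

lemma F_lt: "n < length L \<Longrightarrow> F n = prod_list (map f (L ! n))"
  by (simp add: F_def canon_lt prod_mset_prod_list flip: mset_map)

lemma F_ge: "length L \<le> n \<Longrightarrow> F n = f p * F (n - p)"
  by (simp add: F_def canon_ge)

lemma canon_partition: "0 \<notin># canon p L n \<and> sum_mset (canon p L n) = n"
proof (induction n rule: less_induct)
  case (less n)
  then show ?case
    using period sum_table[of n] less[of "n - p"]
    by (cases "n < length L") (auto simp: canon_lt canon_ge sum_mset_sum_list)
qed

text \<open>If one argument lies beyond the table, so does the sum. Both sides then lose the same
  factor \<open>f p\<close>, which leaves the inequality for a smaller sum.\<close>

lemma super: "F m * F k \<le> F (m + k)"
proof (induction "m + k" arbitrary: m k rule: less_induct)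
  case less
  consider "m < length L" "k < length L" | "length L \<le> m" | "length L \<le> k"
    by linarith
  then show ?case
  proof cases
    case 2
    then have "F (m - p) * F k \<le> F (m - p + k)" using period by (intro less) auto
    then show ?thesis using 2 period by (simp add: F_ge mult.assoc)
  next
    case 3
    then have "F m * F (k - p) \<le> F (m + (k - p))" using period by (intro less) auto
    then show ?thesis using 3 period by (simp add: F_ge mult.left_commute)
  qed (rule super_table)
qed

text \<open>Induction on k: beyond the table, one period is taken off k and off m + k. The positive
  factor \<open>f p\<close> cancels in the equation, and the part \<open>p\<close> is put back
  afterwards.\<close>

lemma unique_step:
  assumes "m \<in> E" "m + k \<notin> X" "F m * F k = F (m + k)"
  shows "k \<notin> X \<and> canon p L (m + k) = add_mset m (canon p L k)"
  using assms(2,3)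
proof (induction k rule: less_induct)
  case (less k)
  show ?case
  proof (cases "k < length L")
    case False
    \<comment> \<open>All of \<open>X\<close> lies below \<open>length L - p\<close>, so numbers
      beyond the table stay outside \<open>X\<close> when one period is subtracted.\<close>
    have X: "k \<notin> X" "m + (k - p) \<notin> X" using False exceptional period by auto
    have "F m * F (k - p) = F (m + (k - p))"
      using less.prems(2) False period pos_period by (simp add: F_ge mult.left_commute)
    then have "canon p L (m + (k - p)) = add_mset m (canon p L (k - p))"
      using less.IH[of "k - p"] False period X by auto
    then show ?thesis
      using X False period by (simp add: canon_ge add_mset_commute)
  qed (use assms(1) less.prems unique_table in blast)
qed

lemma F_pos: "n \<notin> X \<Longrightarrow> 0 < F n"
proof (induction n rule: less_induct)
  case (less n)
  show ?case
  proof (cases "n < length L")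
    case False
    then have "n - p \<notin> X" using exceptional by auto
    then show ?thesis using less.IH[of "n - p"] False period pos_period by (simp add: F_ge)
  qed (use less.prems pos_table in blast)
qed

text \<open>Induction on the parts through the chain f m * P \<le> F m * P \<le> F m * F k \<le> F
  (m + k). Equality of the ends forces equality throughout, and \<open>unique_step\<close> then
  identifies the partition.\<close>

lemma prod_le_F:
  assumes "0 \<notin># M"
  shows "prod_mset (image_mset f M) \<le> F (sum_mset M) \<and>
    (sum_mset M \<notin> X \<longrightarrow> prod_mset (image_mset f M) = F (sum_mset M) \<longrightarrow> M = canon p L (sum_mset M))"
  using assms
proof (induction M)
  case empty
  have "canon p L 0 = {#}"
    using canon_partition[of 0] by (metis multiset_nonemptyE sum_mset_0_iff)
  then show ?case by (simp add: F_def)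
next
  case (add m M)
  define k P where "k = sum_mset M" and "P = prod_mset (image_mset f M)"
  have m: "0 < m" and le: "P \<le> F k" and eqP: "k \<notin> X \<Longrightarrow> P = F k \<Longrightarrow> M = canon p L k"
    using add by (auto simp: k_def P_def)
  have le1: "f m * P \<le> F m * P" using f_le[OF m] by simp
  have le2: "F m * P \<le> F m * F k" using le by simp
  have le3: "F m * F k \<le> F (m + k)" by (rule super)
  have uniq: "add_mset m M = canon p L (m + k)" if nX: "m + k \<notin> X" and eq: "f m * P = F (m + k)"
  proof -
    have eqs: "F m * P = f m * P" "F m * F k = F m * P" "F m * F k = F (m + k)"
      using le1 le2 le3 eq by linarith+
    \<comment> \<open>Outside \<open>X\<close> the value F (m + k) is positive, so \<open>P\<close>
      cancels from the first equation and \<open>F m\<close> from the second.\<close>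
    then have "F m \<noteq> 0" "P \<noteq> 0" using F_pos[OF nX] eq by (metis mult_is_0 less_numeral_extra(3))+
    then have "f m = F m" "P = F k" using eqs(1,2) by auto
    moreover have "m \<in> E" using f_eq[OF m] calculation by simp
    ultimately show ?thesis using unique_step[OF _ nX eqs(3)] eqP by simp
  qed
  have le4: "f m * P \<le> F (m + k)" using le1 le2 le3 by linarith
  have eqs: "sum_mset (add_mset m M) = m + k" "prod_mset (image_mset f (add_mset m M)) = f m * P"
    by (simp_all add: k_def P_def)
  show ?case unfolding eqs using le4 uniq by blast
qed

lemma partition_prod_le_F:
  assumes "xs \<in> partitions_of n"
  shows "prod_list (map f xs) \<le> F n"
    and "n \<notin> X \<Longrightarrow> prod_list (map f xs) = F n \<Longrightarrow> mset xs = canon p L n"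
  using prod_le_F[of "mset xs"] assms
  by (auto simp: partitions_of_def sum_mset_sum_list prod_mset_prod_list simp flip: mset_map)

end

text \<open>A partition is the sorted listing of its multiset, so uniqueness of the multiset yields
  a single maximizing list.\<close>

lemma periodic_maximum_rank_count:
  assumes "periodic_maximum (rank_count r 3) p L E X" "n \<notin> X"
    and "sorted_wrt (\<ge>) ys" "mset ys = canon p L n"
  shows "max_rank_count r 3 n = prod_list (map (rank_count r 3) ys)"
    and "maximizers r 3 n = {ys}"
proof -
  interpret periodic_maximum "rank_count r 3" p L E X
    "\<lambda>n. prod_mset (image_mset (rank_count r 3) (canon p L n))"
    by (rule assms(1))
  let ?F = "prod_mset (image_mset (rank_count r 3) (canon p L n))"
  have F: "prod_list (map (rank_count r 3) ys) = ?F"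
    by (simp add: prod_mset_prod_list flip: mset_map assms(4))
  have ys: "ys \<in> partitions_of n"
    using canon_partition[of n] assms(3)
    by (auto simp: partitions_of_def sum_mset_sum_list simp flip: assms(4) intro!: gr0I)
  have max: "max_rank_count r 3 n = ?F"
    unfolding max_rank_count_def
  proof (rule Max_eqI)
    show "?F \<in> rank_count_mult r 3 ` partitions_of n"
      by (rule rev_image_eqI[OF ys]) (simp add: rank_count_mult_def F)
  qed (use partition_prod_le_F(1) finite_partitions_of in \<open>auto simp: rank_count_mult_def\<close>)
  then show "max_rank_count r 3 n = prod_list (map (rank_count r 3) ys)"
    by (simp add: F)
  have "xs = ys" if "xs \<in> maximizers r 3 n" for xs
  proof -
    have xs: "xs \<in> partitions_of n" "prod_list (map (rank_count r 3) xs) = ?F"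
      using that by (auto simp: maximizers_def rank_count_mult_def max)
    then have "mset xs = mset ys"
      using partition_prod_le_F(2)[OF xs(1) assms(2)] assms(4) by simp
    then show ?thesis
      using bij_betw_imp_inj_on[OF bij_betw_mset_partitions] xs(1) ys by (auto dest: inj_onD)
  qed
  then show "maximizers r 3 n = {ys}"
    using ys by (auto simp: maximizers_def max F rank_count_mult_def)
qed

subsection \<open>The tables of optimal partitions\<close>

text \<open>The constant 186/25 is the maximum of p(n) / (5/4)^n, attained at n = 24, rounded up.\<close>

lemma card_partitions_of_le: "real (card (partitions_of n)) \<le> 186 / 25 * (5 / 4) ^ n"
proof (rule card_partitions_of_le_exp)
  fix n :: nat assume n: "n \<le> 40"
  note [simp del] = One_nat_def
  have upt: "[1..<41::nat] = 1 # [Suc 1..<41]"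
    by (rule upt_conv_Cons) simp
  note simps = rank_counts_table[unfolded upt, simplified]
  \<comment> \<open>The three rank counts of n add up to p(n), so the rank table also supplies the
    partition numbers.\<close>
  have table: "\<forall>n\<in>set [1..<41]. case rank_counts n of (x, y, z) \<Rightarrow>
      real (x + y + z) \<le> 186 / 25 * (5 / 4) ^ n"
    unfolding upt by (simp add: simps power_divide)
  show "real (card (partitions_of n)) \<le> 186 / 25 * (5 / 4) ^ n"
  proof (cases "n = 0")
    case True
    have "partitions_of 0 = {[]}"
      by (auto simp: partitions_of_def) (metis list.set_intros(1) neq_Nil_conv less_numeral_extra(3))
    then show ?thesis by (simp add: True)
  next
    case False
    then have "n \<in> set [1..<41]" using n by auto
    then show ?thesis using bspec[OF table]
      by (auto simp: rank_counts_def card_partitions_of_eq_sum_rank_count)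
  qed
qed simp

text \<open>Reduces the locale to finite checks. Up to 40, f is compared with F by table. From 41
  on, f m \<le> p(m) < F m: this is tested on one window of length p and propagates, as a further
  period multiplies F by \<open>f p\<close> and the bound on p(m) by (5/4)^p, which is at most
  \<open>f p\<close>.\<close>

lemma periodic_maximum_of_tables:
  fixes f :: "nat \<Rightarrow> nat" and p :: nat and L :: "nat list list" and E X :: "nat set"
  defines "F n \<equiv> prod_mset (image_mset f (canon p L n))"
  assumes f_le_card: "\<And>m. f m \<le> card (partitions_of m)"
    and period: "0 < p" "p \<le> length L" "length L \<le> 41"
    and sum_table: "\<forall>n\<in>set [0..<length L]. 0 \<notin> set (L ! n) \<and> sum_list (L ! n) = n"
    and super_table: "\<forall>m\<in>set [0..<length L]. \<forall>k\<in>set [0..<length L]. F m * F k \<le> F (m + k)"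
    and unique_table: "\<forall>m\<in>E. \<forall>k\<in>set [0..<length L].
      m + k \<notin> X \<longrightarrow> F m * F k = F (m + k) \<longrightarrow>
      k \<notin> X \<and> canon p L (m + k) = add_mset m (canon p L k)"
    and exceptional: "X \<subseteq> {..<length L - p}"
    and pos_table: "\<forall>n\<in>set [0..<length L]. n \<notin> X \<longrightarrow> 0 < F n"
    and f_table: "\<forall>m\<in>set [1..<41]. f m \<le> F m \<and> (f m = F m \<longrightarrow> m \<in> E)"
    and window: "\<forall>m\<in>set [41..<41 + p]. 186 / 25 * (5 / 4) ^ m < real (F m)"
    and growth: "(5 / 4) ^ p \<le> real (f p)"
  shows "periodic_maximum f p L E X"
proof -
  have tail: "186 / 25 * (5 / 4) ^ m < real (F m)" if "41 \<le> m" for m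
    using that
  proof (induction m rule: less_induct)
    case (less m)
    show ?case
    proof (cases "m < 41 + p")
      case True
      then show ?thesis using window less.prems by simp
    next
      case False
      have "186 / 25 * (5 / 4) ^ m = (5 / 4) ^ p * (186 / 25 * (5 / 4) ^ (m - p) :: real)"
        using False by (simp flip: power_add)
      also have "\<dots> \<le> real (f p) * (186 / 25 * (5 / 4) ^ (m - p))"
        by (rule mult_right_mono[OF growth]) simp
      also have "\<dots> < real (f p) * real (F (m - p))"
      proof (rule mult_strict_left_mono)
        show "186 / 25 * (5 / 4) ^ (m - p) < real (F (m - p))"
          using less.IH[of "m - p"] less.prems False period by simp
        show "0 < real (f p)" by (rule less_le_trans[OF _ growth]) simp
      qed
      also have "\<dots> = real (F m)"
        using False period by (simp add: F_def canon.simps[of p L m])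
      finally show ?thesis .
    qed
  qed
  have f_tail: "f m < F m" if "41 \<le> m" for m
    using tail[OF that] f_le_card[of m] card_partitions_of_le[of m]
    by linarith
  have "m \<in> set [1..<41] \<or> 41 \<le> m" if "0 < m" for m :: nat
    using that by auto
  then have f_le: "f m \<le> F m \<and> (f m = F m \<longrightarrow> m \<in> E)" if "0 < m" for m
    using f_table f_tail[of m] that by (metis nat_less_le)
  have "0 < f p"
    using growth by (metis gr0I not_less of_nat_0 zero_less_divide_iff zero_less_numeral zero_less_power)
  then show ?thesis
    using period sum_table super_table unique_table exceptional pos_table f_le
    unfolding periodic_maximum_def F_def by simp
qed

section \<open>Table and finite checks for rank residue 0\<close>

definition maximal_parts_7 :: "nat list list" where
  "maximal_parts_7 =
    [[], [1], [1, 1], [1, 1, 1], [4], [4, 1], [4, 1, 1], [7], [4, 4], [9], [10], [7, 4], [4, 4,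
    4], [13], [7, 7], [7, 4, 4], [4, 4, 4, 4], [10, 7], [7, 7, 4], [7, 4, 4, 4], [13, 7], [7, 7,
    7], [7, 7, 4, 4], [13, 10], [10, 7, 7], [7, 7, 7, 4], [13, 13], [13, 7, 7], [7, 7, 7, 7],
    [7, 7, 7, 4, 4], [13, 10, 7], [10, 7, 7, 7], [7, 7, 7, 7, 4], [13, 13, 7], [13, 7, 7, 7],
    [7, 7, 7, 7, 7], [13, 13, 10], [13, 10, 7, 7], [10, 7, 7, 7, 7], [13, 13, 13]]"

text \<open>The first set consists of the m for which the single part m is optimal. The second
  records ties: [3] against [1, 1, 1], [6] against [4, 1, 1], and [16] against [4, 4, 4, 4].\<close>

lemma periodic_maximum_maximal_parts_7:
  assumes f_small: "\<And>m. 0 < m \<Longrightarrow> m \<le> 40 \<Longrightarrow> f m = rank_count 0 3 m"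
    and f_le_card: "\<And>m. f m \<le> card (partitions_of m)"
  shows "periodic_maximum f 7 maximal_parts_7 {1, 3, 4, 6, 7, 9, 10, 13, 16} {3, 6, 16}"
proof -
  note [simp del] = One_nat_def
  define C where "C = canon 7 maximal_parts_7"
  define F where "F n = prod_mset (image_mset f (C n))" for n
  have upt: "[1..<41] = 1 # [Suc 1..<41]" "[0..<40] = 0 # 1 # [Suc 1..<40]"
    "[0..<80] = 0 # 1 # [Suc 1..<80]"
    by (simp_all add: upt_conv_Cons[of 0] upt_conv_Cons[of "Suc 0"] One_nat_def del: upt_rec_numeral)
  have f: "map f [1..<41] =
    [1, 0, 1, 3, 1, 3, 7, 6, 10, 16, 16, 25, 37, 43, 58, 81, 95, 127, 168, 205, 264, 340, 413,
    523, 660, 806, 1002, 1248, 1513, 1866, 2292, 2775, 3379, 4116, 4949, 5989, 7227, 8659,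
    10393, 12464]"
    (is "_ = ?f")
  proof -
    have "map f [1..<41] = map (\<lambda>m. fst (rank_counts m)) [1..<41]"
      using f_small by (simp add: rank_counts_def del: upt_rec_numeral)
    also have "\<dots> = map fst (map rank_counts [1..<41])"
      by (simp del: upt_rec_numeral)
    also have "\<dots> = ?f"
      unfolding rank_counts_table by simp
    finally show ?thesis .
  qed
  note f_simps [simp] = f[unfolded upt, simplified]
  \<comment> \<open>The table stops at 39 because [13, 13, 13] is the last optimal partition without
    a part 7. Its last period starts at 33, the threshold of the theorem.\<close>
  have len [simp]: "length maximal_parts_7 = 40" by (simp add: maximal_parts_7_def)
  have C_lt: "n < 40 \<Longrightarrow> C n = mset (maximal_parts_7 ! n)" for n
    by (simp add: C_def canon.simps)
  have C_ge: "40 \<le> n \<Longrightarrow> C n = add_mset 7 (C (n - 7))" for n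
    unfolding C_def by (subst canon.simps) simp
  have "map C [0..<40] = map mset maximal_parts_7"
    by (rule nth_equalityI) (simp_all add: C_lt del: upt_rec_numeral)
  note C_simps = this[unfolded upt maximal_parts_7_def, simplified]
  have F_lt: "n < 40 \<Longrightarrow> F n = prod_list (map f (maximal_parts_7 ! n))" for n
    by (simp add: F_def C_lt prod_mset_prod_list flip: mset_map)
  have F_ge: "40 \<le> n \<Longrightarrow> F n = f 7 * F (n - 7)" for n
    by (simp add: F_def C_ge)
  \<comment> \<open>Sums of two table indices reach 78, so F is tabulated over twice the length of
    the table.\<close>
  have F_table: "map F [0..<80] =
    [1, 1, 1, 1, 3, 3, 3, 7, 9, 10, 16, 21, 27, 37, 49, 63, 81, 112, 147, 189, 259, 343, 441,
    592, 784, 1029, 1369, 1813, 2401, 3087, 4144, 5488, 7203, 9583, 12691, 16807, 21904, 29008,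
    38416, 50653, 67081, 88837, 117649, 153328, 203056, 268912, 354571, 469567, 621859, 823543,
    1073296, 1421392, 1882384, 2481997, 3286969, 4353013, 5764801, 7513072, 9949744, 13176688,
    17373979, 23008783, 30471091, 40353607, 52591504, 69648208, 92236816, 121617853, 161061481,
    213297637, 282475249, 368140528, 487537456, 645657712, 851324971, 1127430367, 1493083459,
    1977326743, 2576983696, 3412762192]"
    unfolding upt by (simp add: F_lt F_ge maximal_parts_7_def)
  note F_simps [simp] = F_table[unfolded upt, simplified]
  have sum_table: "\<forall>n\<in>set [0..<40]. 0 \<notin> set (maximal_parts_7 ! n) \<and> sum_list (maximal_parts_7 ! n) = n"
    unfolding upt by (simp add: maximal_parts_7_def)
  have super_table: "\<forall>m\<in>set [0..<40]. \<forall>k\<in>set [0..<40]. F m * F k \<le> F (m + k)"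
    unfolding upt by (simp flip: numeral_2_eq_2)
  have unique_table: "\<forall>m\<in>{1, 3, 4, 6, 7, 9, 10, 13, 16}. \<forall>k\<in>set [0..<40].
      m + k \<notin> {3, 6, 16} \<longrightarrow> F m * F k = F (m + k) \<longrightarrow>
      k \<notin> {3, 6, 16} \<and> C (m + k) = add_mset m (C k)"
    unfolding upt by (simp add: C_simps C_ge flip: numeral_2_eq_2)
  have pos_table: "\<forall>n\<in>set [0..<40]. n \<notin> {3, 6, 16} \<longrightarrow> 0 < F n"
    unfolding upt by simp
  have f_table: "\<forall>m\<in>set [1..<41]. f m \<le> F m \<and> (f m = F m \<longrightarrow> m \<in> {1, 3, 4, 6, 7, 9, 10, 13, 16})"
    unfolding upt by simp
  have window: "\<forall>m\<in>set [41..<41 + 7]. 186 / 25 * (5 / 4) ^ m < real (F m)"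
    by (simp add: power_divide)
  note maximum = periodic_maximum_of_tables[of f 7 maximal_parts_7, unfolded len, folded C_def, folded F_def]
  show ?thesis
    by (rule maximum[OF f_le_card _ _ _ sum_table super_table unique_table _ pos_table f_table window])
       (simp_all add: power_divide)
qed

section \<open>Table and finite checks for rank residues 1 and 2\<close>

definition maximal_parts_14 :: "nat list list" where
  "maximal_parts_14 =
    [[], [1], [2], [3], [2, 2], [5], [6], [7], [8], [9], [10], [11], [12], [13], [14], [15],
    [16], [17], [18], [19], [20], [21], [11, 11], [12, 11], [12, 12], [14, 11], [14, 12], [15,
    12], [14, 14], [15, 14], [15, 15], [17, 14], [17, 15], [11, 11, 11], [12, 11, 11], [12, 12,
    11]]"

text \<open>Only the values up to 40 and the bound by p(m) enter, so residue 2 is served as well.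
  Single parts are optimal up to 21. Of the exceptions, 1 has product 0 and 4 has the tie [4]
  against [2, 2].\<close>

lemma periodic_maximum_maximal_parts_14:
  assumes f_small: "\<And>m. 0 < m \<Longrightarrow> m \<le> 40 \<Longrightarrow> f m = rank_count 1 3 m"
    and f_le_card: "\<And>m. f m \<le> card (partitions_of m)"
  shows "periodic_maximum f 14 maximal_parts_14
    {1, 2, 3, 4, 5, 6, 7, 8, 9, 10, 11, 12, 13, 14, 15, 16, 17, 18, 19, 20, 21} {1, 4}"
proof -
  note [simp del] = One_nat_def
  define C where "C = canon 14 maximal_parts_14"
  define F where "F n = prod_mset (image_mset f (C n))" for n
  have upt: "[1..<41] = 1 # [Suc 1..<41]" "[0..<36] = 0 # 1 # [Suc 1..<36]"
    "[0..<72] = 0 # 1 # [Suc 1..<72]"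
    by (simp_all add: upt_conv_Cons[of 0] upt_conv_Cons[of "Suc 0"] One_nat_def del: upt_rec_numeral)
  have f: "map f [1..<41] =
    [0, 1, 1, 1, 3, 4, 4, 8, 10, 13, 20, 26, 32, 46, 59, 75, 101, 129, 161, 211, 264, 331, 421,
    526, 649, 815, 1004, 1235, 1526, 1869, 2275, 2787, 3382, 4097, 4967, 5994, 7205, 8678,
    10396, 12437]"
    (is "_ = ?f")
  proof -
    have "map f [1..<41] = map (\<lambda>m. fst (snd (rank_counts m))) [1..<41]"
      using f_small by (simp add: rank_counts_def del: upt_rec_numeral)
    also have "\<dots> = map (fst \<circ> snd) (map rank_counts [1..<41])"
      by (simp del: upt_rec_numeral)
    also have "\<dots> = ?f"
      unfolding rank_counts_table by simp
    finally show ?thesis .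
  qed
  note f_simps [simp] = f[unfolded upt, simplified]
  \<comment> \<open>Here [12, 12, 11], for 35, is the last optimal partition without a part 14, and
    the last period starts at 22.\<close>
  have len [simp]: "length maximal_parts_14 = 36" by (simp add: maximal_parts_14_def)
  have C_lt: "n < 36 \<Longrightarrow> C n = mset (maximal_parts_14 ! n)" for n
    by (simp add: C_def canon.simps)
  have C_ge: "36 \<le> n \<Longrightarrow> C n = add_mset 14 (C (n - 14))" for n
    unfolding C_def by (subst canon.simps) simp
  have "map C [0..<36] = map mset maximal_parts_14"
    by (rule nth_equalityI) (simp_all add: C_lt del: upt_rec_numeral)
  note C_simps = this[unfolded upt maximal_parts_14_def, simplified]
  have F_lt: "n < 36 \<Longrightarrow> F n = prod_list (map f (maximal_parts_14 ! n))" for n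
    by (simp add: F_def C_lt prod_mset_prod_list flip: mset_map)
  have F_ge: "36 \<le> n \<Longrightarrow> F n = f 14 * F (n - 14)" for n
    by (simp add: F_def C_ge)
  have F_table: "map F [0..<72] =
    [1, 0, 1, 1, 1, 3, 4, 4, 8, 10, 13, 20, 26, 32, 46, 59, 75, 101, 129, 161, 211, 264, 400,
    520, 676, 920, 1196, 1534, 2116, 2714, 3481, 4646, 5959, 8000, 10400, 13520, 18400, 23920,
    31096, 42320, 55016, 70564, 97336, 124844, 160126, 213716, 274114, 368000, 478400, 621920,
    846400, 1100320, 1430416, 1946720, 2530736, 3245944, 4477456, 5742824, 7365796, 9830936,
    12609244, 16928000, 22006400, 28608320, 38934400, 50614720, 65799136, 89549120, 116413856,
    149313424, 205962976, 264169904]"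
    unfolding upt by (simp add: F_lt F_ge maximal_parts_14_def)
  note F_simps [simp] = F_table[unfolded upt, simplified]
  have sum_table: "\<forall>n\<in>set [0..<36]. 0 \<notin> set (maximal_parts_14 ! n) \<and> sum_list (maximal_parts_14 ! n) = n"
    unfolding upt by (simp add: maximal_parts_14_def)
  have super_table: "\<forall>m\<in>set [0..<36]. \<forall>k\<in>set [0..<36]. F m * F k \<le> F (m + k)"
    unfolding upt by (simp flip: numeral_2_eq_2)
  have unique_table: "\<forall>m\<in>{1, 2, 3, 4, 5, 6, 7, 8, 9, 10, 11, 12, 13, 14, 15, 16, 17, 18, 19, 20, 21}.
      \<forall>k\<in>set [0..<36].
      m + k \<notin> {1, 4} \<longrightarrow> F m * F k = F (m + k) \<longrightarrow>
      k \<notin> {1, 4} \<and> C (m + k) = add_mset m (C k)"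
    unfolding upt by (simp add: C_simps C_ge flip: numeral_2_eq_2)
  have pos_table: "\<forall>n\<in>set [0..<36]. n \<notin> {1, 4} \<longrightarrow> 0 < F n"
    unfolding upt by simp
  have f_table: "\<forall>m\<in>set [1..<41]. f m \<le> F m \<and> (f m = F m \<longrightarrow>
      m \<in> {1, 2, 3, 4, 5, 6, 7, 8, 9, 10, 11, 12, 13, 14, 15, 16, 17, 18, 19, 20, 21})"
    unfolding upt by simp
  have window: "\<forall>m\<in>set [41..<41 + 14]. 186 / 25 * (5 / 4) ^ m < real (F m)"
    by (simp add: power_divide)
  note maximum = periodic_maximum_of_tables[of f 14 maximal_parts_14, unfolded len, folded C_def, folded F_def]
  show ?thesis
    by (rule maximum[OF f_le_card _ _ _ sum_table super_table unique_table _ pos_table f_table window])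
       (simp_all add: power_divide)
qed

subsection \<open>The maxima for all residue classes\<close>

text \<open>Already \<open>b + p\<close> lies beyond the table, so each step of length p from
  \<open>b\<close> adds one part \<open>p\<close>, even when \<open>b\<close> itself is a table
  entry.\<close>

lemma canon_add_periods:
  assumes "0 < p" "p \<le> b" "length L \<le> b + p"
  shows "canon p L (b + p * q) = canon p L b + replicate_mset q p"
proof (induction q)
  case (Suc q)
  have "canon p L (b + p * Suc q) = add_mset p (canon p L (b + p * q))"
    using assms by (subst canon.simps) (auto simp: algebra_simps)
  then show ?case using Suc.IH by simp
qed simp

lemma replicate_mset_plus_add:
  "replicate_mset (m + n) x = replicate_mset m x + replicate_mset n x"
  by (induction m) simp_all

lemma replicate_mset_numeral:
  "replicate_mset (numeral k) x = add_mset x (replicate_mset (pred_numeral k) x)"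
  by (simp add: numeral_eq_Suc)

text \<open>
  The residue class of n determines a number b in the last period of the table; the
  number c is the sum of the parts other than p.
\<close>

lemma rank_count_maximum:
  assumes max: "periodic_maximum (rank_count r 3) p L E X"
    and base: "canon p L b = mset (xs @ ys) + replicate_mset ((b - c) div p) p"
      "p \<le> b" "b < length L" "length L \<le> b + p" "c \<le> b" "b mod p = c mod p"
    and n: "length L - p \<le> n" "n mod p = c mod p"
    and sorted: "sorted_wrt (\<ge>) (xs @ p # ys)"
  shows "max_rank_count r 3 n =
      prod_list (map (rank_count r 3) (xs @ ys)) * rank_count r 3 p ^ ((n - c) div p)"
    and "maximizers r 3 n = {xs @ replicate ((n - c) div p) p @ ys}"
proof -
  interpret periodic_maximum "rank_count r 3" p L E X
    "\<lambda>n. prod_mset (image_mset (rank_count r 3) (canon p L n))"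
    by (rule max)
  let ?zs = "xs @ replicate ((n - c) div p) p @ ys"
  have mod_eq: "n mod p = b mod p" using n base by simp
  \<comment> \<open>Since \<open>b\<close> lies in the last period of the table and n is not below
    the start of that period, n < b would make two congruent numbers differ by less than p.\<close>
  have "b \<le> n"
  proof (rule ccontr)
    assume "\<not> b \<le> n"
    then have "p dvd b - n" "0 < b - n" "b - n < p"
      using mod_eq_dvd_iff_nat[of n b p] mod_eq base n by auto
    then show False by (meson nat_dvd_not_less)
  qed
  have "p dvd n - b" "p dvd b - c"
    using mod_eq_dvd_iff_nat[of b n p] mod_eq_dvd_iff_nat[of c b p] \<open>b \<le> n\<close> mod_eq base by auto
  \<comment> \<open>The parts \<open>p\<close> of the result are those added beyond b together with
    those already present in the table entry for b.\<close>
  then have q: "n = b + p * ((n - b) div p)" and "(n - c) div p = (n - b) div p + (b - c) div p"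
    using \<open>b \<le> n\<close> base div_plus_div_distrib_dvd_left[of p "n - b" "b - c"] by auto
  then have "mset ?zs = canon p L n"
    using canon_add_periods[OF period(1) base(2,4), of "(n - b) div p"] base(1)
    by (simp add: replicate_mset_plus_add add.commute add.left_commute)
  \<comment> \<open>One \<open>p\<close> between \<open>xs\<close> and \<open>ys\<close> in the
    assumed sorted list covers every number of copies, zero included.\<close>
  moreover have "sorted_wrt (\<ge>) (replicate k p)" for k
    by (induction k) auto
  then have "sorted_wrt (\<ge>) ?zs"
    using sorted by (auto simp: sorted_wrt_append)
  moreover have "n \<notin> X" using exceptional n(1) by auto
  ultimately show "maximizers r 3 n = {?zs}"
    and "max_rank_count r 3 n =
      prod_list (map (rank_count r 3) (xs @ ys)) * rank_count r 3 p ^ ((n - c) div p)"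
    using periodic_maximum_rank_count[OF max, of n ?zs] by (simp_all add: ac_simps)
qed

section \<open>Applying the tables to the rank counts\<close>

lemma rank_count_le_card: "rank_count r 3 n \<le> card (partitions_of n)"
  unfolding rank_count_def by (rule card_mono) (auto simp: finite_partitions_of)

text \<open>Read off the table. The reason behind it is conjugation of partitions, which negates the
  rank.\<close>

lemma rank_count_2_eq_1:
  assumes "0 < n" "n \<le> 40"
  shows "rank_count 2 3 n = rank_count 1 3 n"
proof -
  have "\<forall>(x, y, z)\<in>set (map rank_counts [1..<41]). z = y"
    unfolding rank_counts_table by simp
  moreover have "rank_counts n \<in> set (map rank_counts [1..<41])"
    using assms by simp
  ultimately show ?thesis by (auto simp: rank_counts_def)
qed

lemma rank_count_values:
  "rank_count 0 3 7 = 7" "rank_count 0 3 10 = 16" "rank_count 0 3 13 = 37"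
  "rank_count 1 3 11 = 20" "rank_count 1 3 12 = 26" "rank_count 1 3 14 = 46"
  "rank_count 1 3 15 = 59" "rank_count 1 3 17 = 101"
proof -
  have upt: "[1..<41::nat] = 1 # [Suc 1..<41]"
    by (rule upt_conv_Cons) simp
  show "rank_count 0 3 7 = 7" "rank_count 0 3 10 = 16" "rank_count 0 3 13 = 37"
    "rank_count 1 3 11 = 20" "rank_count 1 3 12 = 26" "rank_count 1 3 14 = 46"
    "rank_count 1 3 15 = 59" "rank_count 1 3 17 = 101"
    using rank_counts_table[unfolded upt] by (simp_all add: rank_counts_def del: One_nat_def)
qed

lemma periodic_maximum_rank_count_0:
  "periodic_maximum (rank_count 0 3) 7 maximal_parts_7 {1, 3, 4, 6, 7, 9, 10, 13, 16} {3, 6, 16}"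
  by (rule periodic_maximum_maximal_parts_7) (simp_all add: rank_count_le_card)

lemma periodic_maximum_rank_count_1_2:
  assumes "r = 1 \<or> r = 2"
  shows "periodic_maximum (rank_count r 3) 14 maximal_parts_14
    {1, 2, 3, 4, 5, 6, 7, 8, 9, 10, 11, 12, 13, 14, 15, 16, 17, 18, 19, 20, 21} {1, 4}"
  using assms
  by (intro periodic_maximum_maximal_parts_14) (auto simp: rank_count_le_card rank_count_2_eq_1)

text \<open>One entry per residue modulo 7, in the order 0, ..., 6, taken from the last period 33,
  ..., 39. The number subtracted is the sum of the parts other than 7.\<close>

lemma canon_maximal_parts_7_window:
  shows "canon 7 maximal_parts_7 35 = mset ([] @ []) + replicate_mset ((35 - 0) div 7) 7"
    and "canon 7 maximal_parts_7 36 = mset ([13, 13, 10] @ []) + replicate_mset ((36 - 36) div 7) 7"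
    and "canon 7 maximal_parts_7 37 = mset ([13, 10] @ []) + replicate_mset ((37 - 23) div 7) 7"
    and "canon 7 maximal_parts_7 38 = mset ([10] @ []) + replicate_mset ((38 - 10) div 7) 7"
    and "canon 7 maximal_parts_7 39 = mset ([13, 13, 13] @ []) + replicate_mset ((39 - 39) div 7) 7"
    and "canon 7 maximal_parts_7 33 = mset ([13, 13] @ []) + replicate_mset ((33 - 26) div 7) 7"
    and "canon 7 maximal_parts_7 34 = mset ([13] @ []) + replicate_mset ((34 - 13) div 7) 7"
  by (simp_all add: canon.simps maximal_parts_7_def replicate_mset_numeral)

text \<open>No subtraction is truncated: for instance n \<ge> 33 and n mod 7 = 4 force n \<ge>
  39.\<close>

lemma maximum_rank_count_mod_7:
  assumes "33 \<le> n"
  shows "n mod 7 = 0 \<Longrightarrow>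
      max_rank_count 0 3 n = 7 ^ (n div 7) \<and>
      maximizers 0 3 n = {replicate (n div 7) 7}"
    and "n mod 7 = 1 \<Longrightarrow>
      max_rank_count 0 3 n = 37^2 * 16 * 7 ^ ((n - 36) div 7) \<and>
      maximizers 0 3 n = {[13, 13, 10] @ replicate ((n - 36) div 7) 7}"
    and "n mod 7 = 2 \<Longrightarrow>
      max_rank_count 0 3 n = 37 * 16 * 7 ^ ((n - 23) div 7) \<and>
      maximizers 0 3 n = {[13, 10] @ replicate ((n - 23) div 7) 7}"
    and "n mod 7 = 3 \<Longrightarrow>
      max_rank_count 0 3 n = 16 * 7 ^ ((n - 10) div 7) \<and>
      maximizers 0 3 n = {[10] @ replicate ((n - 10) div 7) 7}"
    and "n mod 7 = 4 \<Longrightarrow>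
      max_rank_count 0 3 n = 37^3 * 7 ^ ((n - 39) div 7) \<and>
      maximizers 0 3 n = {[13, 13, 13] @ replicate ((n - 39) div 7) 7}"
    and "n mod 7 = 5 \<Longrightarrow>
      max_rank_count 0 3 n = 37^2 * 7 ^ ((n - 26) div 7) \<and>
      maximizers 0 3 n = {[13, 13] @ replicate ((n - 26) div 7) 7}"
    and "n mod 7 = 6 \<Longrightarrow>
      max_rank_count 0 3 n = 37 * 7 ^ ((n - 13) div 7) \<and>
      maximizers 0 3 n = {[13] @ replicate ((n - 13) div 7) 7}"
proof -
  note vals = rank_count_values
  note max = rank_count_maximum[OF periodic_maximum_rank_count_0, where n = n]
  show "max_rank_count 0 3 n = 7 ^ (n div 7) \<and> maximizers 0 3 n = {replicate (n div 7) 7}"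
    if "n mod 7 = 0"
    using max[OF canon_maximal_parts_7_window(1)] assms that
    by (simp add: vals maximal_parts_7_def)
  show "max_rank_count 0 3 n = 37^2 * 16 * 7 ^ ((n - 36) div 7) \<and> maximizers 0 3 n = {[13, 13, 10] @ replicate ((n - 36) div 7) 7}"
    if "n mod 7 = 1"
    using max[OF canon_maximal_parts_7_window(2)] assms that
    by (simp add: vals maximal_parts_7_def)
  show "max_rank_count 0 3 n = 37 * 16 * 7 ^ ((n - 23) div 7) \<and> maximizers 0 3 n = {[13, 10] @ replicate ((n - 23) div 7) 7}"
    if "n mod 7 = 2"
    using max[OF canon_maximal_parts_7_window(3)] assms that
    by (simp add: vals maximal_parts_7_def)
  show "max_rank_count 0 3 n = 16 * 7 ^ ((n - 10) div 7) \<and> maximizers 0 3 n = {[10] @ replicate ((n - 10) div 7) 7}"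
    if "n mod 7 = 3"
    using max[OF canon_maximal_parts_7_window(4)] assms that
    by (simp add: vals maximal_parts_7_def)
  show "max_rank_count 0 3 n = 37^3 * 7 ^ ((n - 39) div 7) \<and> maximizers 0 3 n = {[13, 13, 13] @ replicate ((n - 39) div 7) 7}"
    if "n mod 7 = 4"
    using max[OF canon_maximal_parts_7_window(5)] assms that
    by (simp add: vals maximal_parts_7_def)
  show "max_rank_count 0 3 n = 37^2 * 7 ^ ((n - 26) div 7) \<and> maximizers 0 3 n = {[13, 13] @ replicate ((n - 26) div 7) 7}"
    if "n mod 7 = 5"
    using max[OF canon_maximal_parts_7_window(6)] assms that
    by (simp add: vals maximal_parts_7_def)
  show "max_rank_count 0 3 n = 37 * 7 ^ ((n - 13) div 7) \<and> maximizers 0 3 n = {[13] @ replicate ((n - 13) div 7) 7}"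
    if "n mod 7 = 6"
    using max[OF canon_maximal_parts_7_window(7)] assms that
    by (simp add: vals maximal_parts_7_def)
qed

text \<open>The last period is now 22, ..., 35. The parts 15 and 17 precede the block of 14s, while
  11 and 12 follow it.\<close>

lemma canon_maximal_parts_14_window:
  shows "canon 14 maximal_parts_14 28 = mset ([] @ []) + replicate_mset ((28 - 0) div 14) 14"
    and "canon 14 maximal_parts_14 29 = mset ([15] @ []) + replicate_mset ((29 - 15) div 14) 14"
    and "canon 14 maximal_parts_14 30 = mset ([15, 15] @ []) + replicate_mset ((30 - 30) div 14) 14"
    and "canon 14 maximal_parts_14 31 = mset ([17] @ []) + replicate_mset ((31 - 17) div 14) 14"
    and "canon 14 maximal_parts_14 32 = mset ([17, 15] @ []) + replicate_mset ((32 - 32) div 14) 14"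
    and "canon 14 maximal_parts_14 33 = mset ([] @ [11, 11, 11]) + replicate_mset ((33 - 33) div 14) 14"
    and "canon 14 maximal_parts_14 34 = mset ([] @ [12, 11, 11]) + replicate_mset ((34 - 34) div 14) 14"
    and "canon 14 maximal_parts_14 35 = mset ([] @ [12, 12, 11]) + replicate_mset ((35 - 35) div 14) 14"
    and "canon 14 maximal_parts_14 22 = mset ([] @ [11, 11]) + replicate_mset ((22 - 22) div 14) 14"
    and "canon 14 maximal_parts_14 23 = mset ([] @ [12, 11]) + replicate_mset ((23 - 23) div 14) 14"
    and "canon 14 maximal_parts_14 24 = mset ([] @ [12, 12]) + replicate_mset ((24 - 24) div 14) 14"
    and "canon 14 maximal_parts_14 25 = mset ([] @ [11]) + replicate_mset ((25 - 11) div 14) 14"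
    and "canon 14 maximal_parts_14 26 = mset ([] @ [12]) + replicate_mset ((26 - 12) div 14) 14"
    and "canon 14 maximal_parts_14 27 = mset ([15] @ [12]) + replicate_mset ((27 - 27) div 14) 14"
  by (simp_all add: canon.simps maximal_parts_14_def replicate_mset_numeral)

lemma maximum_rank_count_mod_14:
  assumes "r = 1 \<or> r = 2" and "22 \<le> n"
  shows "n mod 14 = 0 \<Longrightarrow>
      max_rank_count r 3 n = 46 ^ (n div 14) \<and>
      maximizers r 3 n = {replicate (n div 14) 14}"
    and "n mod 14 = 1 \<Longrightarrow>
      max_rank_count r 3 n = 59 * 46 ^ ((n - 15) div 14) \<and>
      maximizers r 3 n = {[15] @ replicate ((n - 15) div 14) 14}"
    and "n mod 14 = 2 \<Longrightarrow>
      max_rank_count r 3 n = 59^2 * 46 ^ ((n - 30) div 14) \<and>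
      maximizers r 3 n = {[15, 15] @ replicate ((n - 30) div 14) 14}"
    and "n mod 14 = 3 \<Longrightarrow>
      max_rank_count r 3 n = 101 * 46 ^ ((n - 17) div 14) \<and>
      maximizers r 3 n = {[17] @ replicate ((n - 17) div 14) 14}"
    and "n mod 14 = 4 \<Longrightarrow>
      max_rank_count r 3 n = 101 * 59 * 46 ^ ((n - 32) div 14) \<and>
      maximizers r 3 n = {[17, 15] @ replicate ((n - 32) div 14) 14}"
    and "n mod 14 = 5 \<Longrightarrow>
      max_rank_count r 3 n = 20^3 * 46 ^ ((n - 33) div 14) \<and>
      maximizers r 3 n = {replicate ((n - 33) div 14) 14 @ [11, 11, 11]}"
    and "n mod 14 = 6 \<Longrightarrow>
      max_rank_count r 3 n = 26 * 20^2 * 46 ^ ((n - 34) div 14) \<and>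
      maximizers r 3 n = {replicate ((n - 34) div 14) 14 @ [12, 11, 11]}"
    and "n mod 14 = 7 \<Longrightarrow>
      max_rank_count r 3 n = 26^2 * 20 * 46 ^ ((n - 35) div 14) \<and>
      maximizers r 3 n = {replicate ((n - 35) div 14) 14 @ [12, 12, 11]}"
    and "n mod 14 = 8 \<Longrightarrow>
      max_rank_count r 3 n = 20^2 * 46 ^ ((n - 22) div 14) \<and>
      maximizers r 3 n = {replicate ((n - 22) div 14) 14 @ [11, 11]}"
    and "n mod 14 = 9 \<Longrightarrow>
      max_rank_count r 3 n = 26 * 20 * 46 ^ ((n - 23) div 14) \<and>
      maximizers r 3 n = {replicate ((n - 23) div 14) 14 @ [12, 11]}"
    and "n mod 14 = 10 \<Longrightarrow>
      max_rank_count r 3 n = 26^2 * 46 ^ ((n - 24) div 14) \<and>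
      maximizers r 3 n = {replicate ((n - 24) div 14) 14 @ [12, 12]}"
    and "n mod 14 = 11 \<Longrightarrow>
      max_rank_count r 3 n = 20 * 46 ^ ((n - 11) div 14) \<and>
      maximizers r 3 n = {replicate ((n - 11) div 14) 14 @ [11]}"
    and "n mod 14 = 12 \<Longrightarrow>
      max_rank_count r 3 n = 26 * 46 ^ ((n - 12) div 14) \<and>
      maximizers r 3 n = {replicate ((n - 12) div 14) 14 @ [12]}"
    and "n mod 14 = 13 \<Longrightarrow>
      max_rank_count r 3 n = 59 * 26 * 46 ^ ((n - 27) div 14) \<and>
      maximizers r 3 n = {[15] @ replicate ((n - 27) div 14) 14 @ [12]}"
proof -
  \<comment> \<open>The closed formulas depend on r only through the values at these five parts,
    which agree for r = 1 and r = 2.\<close>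
  have vals: "rank_count r 3 11 = 20" "rank_count r 3 12 = 26" "rank_count r 3 14 = 46"
    "rank_count r 3 15 = 59" "rank_count r 3 17 = 101"
    using assms(1) rank_count_values by (auto simp: rank_count_2_eq_1)
  note max = rank_count_maximum[OF periodic_maximum_rank_count_1_2[OF assms(1)], where n = n]
  show "max_rank_count r 3 n = 46 ^ (n div 14) \<and> maximizers r 3 n = {replicate (n div 14) 14}"
    if "n mod 14 = 0"
    using max[OF canon_maximal_parts_14_window(1)] assms that
    by (simp add: vals maximal_parts_14_def)
  show "max_rank_count r 3 n = 59 * 46 ^ ((n - 15) div 14) \<and> maximizers r 3 n = {[15] @ replicate ((n - 15) div 14) 14}"
    if "n mod 14 = 1"
    using max[OF canon_maximal_parts_14_window(2)] assms that
    by (simp add: vals maximal_parts_14_def)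
  show "max_rank_count r 3 n = 59^2 * 46 ^ ((n - 30) div 14) \<and> maximizers r 3 n = {[15, 15] @ replicate ((n - 30) div 14) 14}"
    if "n mod 14 = 2"
    using max[OF canon_maximal_parts_14_window(3)] assms that
    by (simp add: vals maximal_parts_14_def)
  show "max_rank_count r 3 n = 101 * 46 ^ ((n - 17) div 14) \<and> maximizers r 3 n = {[17] @ replicate ((n - 17) div 14) 14}"
    if "n mod 14 = 3"
    using max[OF canon_maximal_parts_14_window(4)] assms that
    by (simp add: vals maximal_parts_14_def)
  show "max_rank_count r 3 n = 101 * 59 * 46 ^ ((n - 32) div 14) \<and> maximizers r 3 n = {[17, 15] @ replicate ((n - 32) div 14) 14}"
    if "n mod 14 = 4"
    using max[OF canon_maximal_parts_14_window(5)] assms that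
    by (simp add: vals maximal_parts_14_def)
  show "max_rank_count r 3 n = 20^3 * 46 ^ ((n - 33) div 14) \<and> maximizers r 3 n = {replicate ((n - 33) div 14) 14 @ [11, 11, 11]}"
    if "n mod 14 = 5"
    using max[OF canon_maximal_parts_14_window(6)] assms that
    by (simp add: vals maximal_parts_14_def)
  show "max_rank_count r 3 n = 26 * 20^2 * 46 ^ ((n - 34) div 14) \<and> maximizers r 3 n = {replicate ((n - 34) div 14) 14 @ [12, 11, 11]}"
    if "n mod 14 = 6"
    using max[OF canon_maximal_parts_14_window(7)] assms that
    by (simp add: vals maximal_parts_14_def)
  show "max_rank_count r 3 n = 26^2 * 20 * 46 ^ ((n - 35) div 14) \<and> maximizers r 3 n = {replicate ((n - 35) div 14) 14 @ [12, 12, 11]}"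
    if "n mod 14 = 7"
    using max[OF canon_maximal_parts_14_window(8)] assms that
    by (simp add: vals maximal_parts_14_def)
  show "max_rank_count r 3 n = 20^2 * 46 ^ ((n - 22) div 14) \<and> maximizers r 3 n = {replicate ((n - 22) div 14) 14 @ [11, 11]}"
    if "n mod 14 = 8"
    using max[OF canon_maximal_parts_14_window(9)] assms that
    by (simp add: vals maximal_parts_14_def)
  show "max_rank_count r 3 n = 26 * 20 * 46 ^ ((n - 23) div 14) \<and> maximizers r 3 n = {replicate ((n - 23) div 14) 14 @ [12, 11]}"
    if "n mod 14 = 9"
    using max[OF canon_maximal_parts_14_window(10)] assms that
    by (simp add: vals maximal_parts_14_def)
  show "max_rank_count r 3 n = 26^2 * 46 ^ ((n - 24) div 14) \<and> maximizers r 3 n = {replicate ((n - 24) div 14) 14 @ [12, 12]}"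
    if "n mod 14 = 10"
    using max[OF canon_maximal_parts_14_window(11)] assms that
    by (simp add: vals maximal_parts_14_def)
  show "max_rank_count r 3 n = 20 * 46 ^ ((n - 11) div 14) \<and> maximizers r 3 n = {replicate ((n - 11) div 14) 14 @ [11]}"
    if "n mod 14 = 11"
    using max[OF canon_maximal_parts_14_window(12)] assms that
    by (simp add: vals maximal_parts_14_def)
  show "max_rank_count r 3 n = 26 * 46 ^ ((n - 12) div 14) \<and> maximizers r 3 n = {replicate ((n - 12) div 14) 14 @ [12]}"
    if "n mod 14 = 12"
    using max[OF canon_maximal_parts_14_window(13)] assms that
    by (simp add: vals maximal_parts_14_def)
  show "max_rank_count r 3 n = 59 * 26 * 46 ^ ((n - 27) div 14) \<and> maximizers r 3 n = {[15] @ replicate ((n - 27) div 14) 14 @ [12]}"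
    if "n mod 14 = 13"
    using max[OF canon_maximal_parts_14_window(14)] assms that
    by (simp add: vals maximal_parts_14_def)
qed

theorem theorem1p2:
  shows "(\<forall>n\<ge>33.
      (n mod 7 = 0 \<longrightarrow> max_rank_count 0 3 n = 7 ^ (n div 7)) \<and>
      (n mod 7 = 1 \<longrightarrow> max_rank_count 0 3 n = 37^2 * 16 * 7 ^ ((n - 36) div 7)) \<and>
      (n mod 7 = 2 \<longrightarrow> max_rank_count 0 3 n = 37 * 16 * 7 ^ ((n - 23) div 7)) \<and>
      (n mod 7 = 3 \<longrightarrow> max_rank_count 0 3 n = 16 * 7 ^ ((n - 10) div 7)) \<and>
      (n mod 7 = 4 \<longrightarrow> max_rank_count 0 3 n = 37^3 * 7 ^ ((n - 39) div 7)) \<and>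
      (n mod 7 = 5 \<longrightarrow> max_rank_count 0 3 n = 37^2 * 7 ^ ((n - 26) div 7)) \<and>
      (n mod 7 = 6 \<longrightarrow> max_rank_count 0 3 n = 37 * 7 ^ ((n - 13) div 7)) \<and>
      (n mod 7 = 0 \<longrightarrow> maximizers 0 3 n = {replicate (n div 7) 7}) \<and>
      (n mod 7 = 1 \<longrightarrow> maximizers 0 3 n = {[13, 13, 10] @ replicate ((n - 36) div 7) 7}) \<and>
      (n mod 7 = 2 \<longrightarrow> maximizers 0 3 n = {[13, 10] @ replicate ((n - 23) div 7) 7}) \<and>
      (n mod 7 = 3 \<longrightarrow> maximizers 0 3 n = {[10] @ replicate ((n - 10) div 7) 7}) \<and>
      (n mod 7 = 4 \<longrightarrow> maximizers 0 3 n = {[13, 13, 13] @ replicate ((n - 39) div 7) 7}) \<and>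
      (n mod 7 = 5 \<longrightarrow> maximizers 0 3 n = {[13, 13] @ replicate ((n - 26) div 7) 7}) \<and>
      (n mod 7 = 6 \<longrightarrow> maximizers 0 3 n = {[13] @ replicate ((n - 13) div 7) 7}))
    \<and>
    (\<forall>n\<ge>22.
      max_rank_count 1 3 n = max_rank_count 2 3 n \<and>
      (n mod 14 = 0 \<longrightarrow> max_rank_count 1 3 n = 46 ^ (n div 14)) \<and>
      (n mod 14 = 1 \<longrightarrow> max_rank_count 1 3 n = 59 * 46 ^ ((n - 15) div 14)) \<and>
      (n mod 14 = 2 \<longrightarrow> max_rank_count 1 3 n = 59^2 * 46 ^ ((n - 30) div 14)) \<and>
      (n mod 14 = 3 \<longrightarrow> max_rank_count 1 3 n = 101 * 46 ^ ((n - 17) div 14)) \<and>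
      (n mod 14 = 4 \<longrightarrow> max_rank_count 1 3 n = 101 * 59 * 46 ^ ((n - 32) div 14)) \<and>
      (n mod 14 = 5 \<longrightarrow> max_rank_count 1 3 n = 20^3 * 46 ^ ((n - 33) div 14)) \<and>
      (n mod 14 = 6 \<longrightarrow> max_rank_count 1 3 n = 26 * 20^2 * 46 ^ ((n - 34) div 14)) \<and>
      (n mod 14 = 7 \<longrightarrow> max_rank_count 1 3 n = 26^2 * 20 * 46 ^ ((n - 35) div 14)) \<and>
      (n mod 14 = 8 \<longrightarrow> max_rank_count 1 3 n = 20^2 * 46 ^ ((n - 22) div 14)) \<and>
      (n mod 14 = 9 \<longrightarrow> max_rank_count 1 3 n = 26 * 20 * 46 ^ ((n - 23) div 14)) \<and>
      (n mod 14 = 10 \<longrightarrow> max_rank_count 1 3 n = 26^2 * 46 ^ ((n - 24) div 14)) \<and>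
      (n mod 14 = 11 \<longrightarrow> max_rank_count 1 3 n = 20 * 46 ^ ((n - 11) div 14)) \<and>
      (n mod 14 = 12 \<longrightarrow> max_rank_count 1 3 n = 26 * 46 ^ ((n - 12) div 14)) \<and>
      (n mod 14 = 13 \<longrightarrow> max_rank_count 1 3 n = 59 * 26 * 46 ^ ((n - 27) div 14)) \<and>
      (\<forall>r\<in>{1, 2}.
        (n mod 14 = 0 \<longrightarrow> maximizers r 3 n = {replicate (n div 14) 14}) \<and>
        (n mod 14 = 1 \<longrightarrow> maximizers r 3 n = {[15] @ replicate ((n - 15) div 14) 14}) \<and>
        (n mod 14 = 2 \<longrightarrow> maximizers r 3 n = {[15, 15] @ replicate ((n - 30) div 14) 14}) \<and>
        (n mod 14 = 3 \<longrightarrow> maximizers r 3 n = {[17] @ replicate ((n - 17) div 14) 14}) \<and>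
        (n mod 14 = 4 \<longrightarrow> maximizers r 3 n = {[17, 15] @ replicate ((n - 32) div 14) 14}) \<and>
        (n mod 14 = 5 \<longrightarrow> maximizers r 3 n = {replicate ((n - 33) div 14) 14 @ [11, 11, 11]}) \<and>
        (n mod 14 = 6 \<longrightarrow> maximizers r 3 n = {replicate ((n - 34) div 14) 14 @ [12, 11, 11]}) \<and>
        (n mod 14 = 7 \<longrightarrow> maximizers r 3 n = {replicate ((n - 35) div 14) 14 @ [12, 12, 11]}) \<and>
        (n mod 14 = 8 \<longrightarrow> maximizers r 3 n = {replicate ((n - 22) div 14) 14 @ [11, 11]}) \<and>
        (n mod 14 = 9 \<longrightarrow> maximizers r 3 n = {replicate ((n - 23) div 14) 14 @ [12, 11]}) \<and>
        (n mod 14 = 10 \<longrightarrow> maximizers r 3 n = {replicate ((n - 24) div 14) 14 @ [12, 12]}) \<and>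
        (n mod 14 = 11 \<longrightarrow> maximizers r 3 n = {replicate ((n - 11) div 14) 14 @ [11]}) \<and>
        (n mod 14 = 12 \<longrightarrow> maximizers r 3 n = {replicate ((n - 12) div 14) 14 @ [12]}) \<and>
        (n mod 14 = 13 \<longrightarrow> maximizers r 3 n = {[15] @ replicate ((n - 27) div 14) 14 @ [12]})))"
proof ((rule conjI; intro allI impI), goal_cases)
  case (1 n)
  show ?case
    by (intro conjI impI) (simp_all add: maximum_rank_count_mod_7[OF 1])
next
  case (2 n)
  have less_14: "x = 0 \<or> x = 1 \<or> x = 2 \<or> x = 3 \<or> x = 4 \<or> x = 5 \<or> x = 6 \<or>
      x = 7 \<or> x = 8 \<or> x = 9 \<or> x = 10 \<or> x = 11 \<or> x = 12 \<or> x = 13"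
    if "x < 14" for x :: nat
    using that by (auto simp: numeral_eq_Suc less_Suc_eq)
  have "n mod 14 < 14" by simp
  \<comment> \<open>In each residue class both maxima equal the same closed formula.\<close>
  from less_14[OF this] have eq: "max_rank_count 1 3 n = max_rank_count 2 3 n"
    using maximum_rank_count_mod_14[of 1 n, OF _ 2] maximum_rank_count_mod_14[of 2 n, OF _ 2]
    by (elim disjE) simp_all
  show ?case
    by (intro conjI impI ballI eq)
      (simp_all add: maximum_rank_count_mod_14[OF _ 2])
qed

end
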